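(* Let $\mathcal{T}$ be the ring torus and $\mathcal{Q}$ the quadric given by $T=z^4+p_2z^2+p_0$ and $Q=z^2+q_1z+q_0$ as in the context, let $\mathcal{C}_{\mathbb{R}}=\mathcal{T}\cap\mathcal{Q}\subset\mathbb{R}^3$, and let $\Pi_z(x,y,z)=(x,y)$. Then $$\Pi_z(\mathcal{C}_{\mathbb{R}})=\left\{(x,y)\in\mathbb{R}^2:\ \widehat{\mathbf{S}_0}(x,y)=0,\ \Delta_{\mathcal{T}}(x,y)\le 0,\ \Delta_{\mathcal{Q}}(x,y)\ge 0\right\}.$$
   Context: Fix real numbers $0<r<R$. Put $p_2(x,y)=2(R^2-r^2+x^2+y^2)$, $p_0(x,y)=(R^2+2Rr+r^2-x^2-y^2)(R^2-2Rr+r^2-x^2-y^2)$, $T=z^4+p_2z^2+p_0\in\mathbb{R}[x,y,z]$, and $\mathcal{T}=\{T=0\}\subset\mathbb{R}^3$ (a ring torus). Let $q_1=ex+fy+i$ and $q_0=ax^2+by^2+dxy+gx+hy+j$ with real coefficients, $Q=z^2+q_1z+q_0$, and $\mathcal{Q}=\{Q=0\}\subset\mathbb{R}^3$. Standing assumption: the quadric is irreducible, i.e. neither the square of a plane nor the union of two planes. $\widetilde{\mathbf{S}_0}\in\mathbb{R}[x,y]$ denotes the resultant of $T$ and $Q$ with respect to $z$; explicitly $\widetilde{\mathbf{S}_0}=(q_0q_1^2+p_2q_0-q_0^2-p_0)^2+q_1^2(q_1^2+p_2-2q_0)(p_0-q_0^2)$. $\widehat{\mathbf{S}_0}$ is its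 squarefree part. $\Delta_{\mathcal{T}}=p_0$ and $\Delta_{\mathcal{Q}}=q_1^2-4q_0$. *)

theory Defs
  imports
    "HOL-Computational_Algebra.Computational_Algebra"
    "HOL-Computational_Algebra.Field_as_Ring"
    "Subresultants.Resultant_Prelim"
begin

(* Real polynomials in x, y are elements of real poly poly, i.e. polynomials in y over R[x];
   real poly poly poly adjoins z as the outermost variable, so that the resultant of two
   such polynomials is the one with respect to z. *)

abbreviation cst :: "real \<Rightarrow> real poly poly" where
  "cst c \<equiv> [:[:c:]:]"

abbreviation var_x :: "real poly poly" where
  "var_x \<equiv> [:[:0, 1:]:]"

abbreviation var_y :: "real poly poly" where
  "var_y \<equiv> [:0, 1:]"

definition eval2 :: "real poly poly \<Rightarrow> real \<Rightarrow> real \<Rightarrow> real" where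
  "eval2 p x y = poly (poly p [:y:]) x"

definition eval3 :: "real poly poly poly \<Rightarrow> real \<Rightarrow> real \<Rightarrow> real \<Rightarrow> real" where
  "eval3 P x y z = eval2 (poly P (cst z)) x y"

definition p2 :: "real \<Rightarrow> real \<Rightarrow> real poly poly" where
  "p2 R r = 2 * (cst R ^ 2 - cst r ^ 2 + var_x ^ 2 + var_y ^ 2)"

definition p0 :: "real \<Rightarrow> real \<Rightarrow> real poly poly" where
  "p0 R r =
    (cst R ^ 2 + 2 * cst R * cst r + cst r ^ 2 - var_x ^ 2 - var_y ^ 2) *
    (cst R ^ 2 - 2 * cst R * cst r + cst r ^ 2 - var_x ^ 2 - var_y ^ 2)"

definition torus_poly :: "real \<Rightarrow> real \<Rightarrow> real poly poly poly" where
  "torus_poly R r = [:p0 R r, 0, p2 R r, 0, 1:]"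

definition q1 :: "real \<Rightarrow> real \<Rightarrow> real \<Rightarrow> real poly poly" where
  "q1 e f i = cst e * var_x + cst f * var_y + cst i"

definition q0 :: "real \<Rightarrow> real \<Rightarrow> real \<Rightarrow> real \<Rightarrow> real \<Rightarrow> real \<Rightarrow> real poly poly" where
  "q0 a b d g h j =
    cst a * var_x ^ 2 + cst b * var_y ^ 2 + cst d * var_x * var_y +
    cst g * var_x + cst h * var_y + cst j"

definition quadric_poly :: "real poly poly \<Rightarrow> real poly poly \<Rightarrow> real poly poly poly" where
  "quadric_poly u1 u0 = [:u0, u1, 1:]"

definition zero_set :: "real poly poly poly \<Rightarrow> (real \<times> real \<times> real) set" where
  "zero_set P = {(x, y, z). eval3 P x y z = 0}"

definition proj_z :: "real \<times> real \<times> real \<Rightarrow> real \<times> real" where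
  "proj_z = (\<lambda>(x, y, z). (x, y))"

(* The product of the distinct prime factors. The library's squarefree_part is a different
   notion: it keeps only the prime factors of odd multiplicity. The squarefree part is
   determined up to a unit (a nonzero real constant for polynomials over the reals); here it
   is normalized. *)
definition sqfree_part :: "'a :: factorial_semiring \<Rightarrow> 'a" where
  "sqfree_part p = (if p = 0 then 0 else \<Prod>(prime_factors p))"

definition S0_tilde :: "real poly poly poly \<Rightarrow> real poly poly poly \<Rightarrow> real poly poly" where
  "S0_tilde T Q = resultant T Q"

definition S0_hat :: "real poly poly poly \<Rightarrow> real poly poly poly \<Rightarrow> real poly poly" where
  "S0_hat T Q = sqfree_part (S0_tilde T Q)"

definition Delta_T :: "real \<Rightarrow> real \<Rightarrow> real poly poly" where
  "Delta_T R r = p0 R r"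

definition Delta_Q :: "real poly poly \<Rightarrow> real poly poly \<Rightarrow> real poly poly" where
  "Delta_Q u1 u0 = u1 ^ 2 - 4 * u0"

lemma eval3_torus_poly:
  "eval3 (torus_poly R r) x y z =
     z ^ 4 + 2 * (R^2 - r^2 + x^2 + y^2) * z^2 +
     (R^2 + 2 * R * r + r^2 - x^2 - y^2) * (R^2 - 2 * R * r + r^2 - x^2 - y^2)"
  by (simp add: eval3_def eval2_def torus_poly_def p2_def p0_def algebra_simps
      power2_eq_square power4_eq_xxxx)

lemma eval3_quadric_poly:
  "eval3 (quadric_poly (q1 e f i) (q0 a b d g h j)) x y z =
     z^2 + (e * x + f * y + i) * z +
     (a * x^2 + b * y^2 + d * x * y + g * x + h * y + j)"
  by (simp add: eval3_def eval2_def quadric_poly_def q1_def q0_def algebra_simps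
      power2_eq_square)

end

theory Submission
  imports Defs "Subresultants.Subresultant_Gcd"
begin

text \<open>
  Fix a point \<open>(x, y)\<close> and specialize both polynomials there, which turns them into univariate
  real polynomials in \<open>z\<close>. Both are monic in \<open>z\<close>, so no degree drops and the resultant
  specializes to the resultant of the specializations; and passing to the squarefree part does not
  change the vanishing locus. Hence the first condition on the right says precisely that the
  specialized quartic and quadratic have a common factor, that is, a common \<^emph>\<open>complex\<close> root
  (lemmas \<open>eval2_sqfree_part_eq_0_iff\<close> and \<open>eval2_resultant_monic\<close>). What remains is that the sign
  conditions make such a root real, and that they hold wherever there is a real one.

  \<^item> A real quadratic with nonnegative discriminant splits into real linear factors, so every root it
    shares with the quartic is real. Conversely a real root forces the discriminant to be
    nonnegative (lemmas \<open>resultant_quadratic_eq_0_iff\<close> and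
    \<open>quadratic_root_imp_discriminant_nonneg\<close>).
  \<^item> The quartic is \<open>w\<^sup>2 + p\<^sub>2 w + p\<^sub>0\<close> in \<open>w = z\<^sup>2\<close>, and \<open>p\<^sub>2 \<ge> 0\<close> everywhere because \<open>0 < r < R\<close>.
    At a real zero \<open>w \<ge> 0\<close>, so \<open>p\<^sub>0 = - w (w + p\<^sub>2) \<le> 0\<close>
    (lemma \<open>torus_zero_imp_Delta_T_nonpos\<close>).
\<close>

lemma sqfree_part_dvd: "sqfree_part p dvd p"
proof (cases "p = 0")
  case False
  let ?A = "prime_factorization p"
  have "prod_mset (mset_set (set_mset ?A)) dvd prod_mset ?A"
    by (rule prod_mset_subset_imp_dvd) (rule mset_set_set_mset_msubset)
  also have "prod_mset ?A dvd p"
    by (metis False dvd_normalize_iff dvd_refl normalize_dvd_iff prod_mset_prime_factorization_weak)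
  finally show ?thesis
    using False by (simp add: sqfree_part_def prod_unfold_prod_mset)
qed simp

text \<open>
  Each prime factor divides the squarefree part, so as an exponent the number of prime factors,
  counted with multiplicity, is large enough.
\<close>
lemma dvd_sqfree_part_power: "\<exists>n. p dvd sqfree_part p ^ n"
proof (cases "p = 0")
  case True
  then show ?thesis
    by (intro exI[of _ 1]) (simp add: sqfree_part_def)
next
  case False
  let ?s = "sqfree_part p"
  have "prod_mset A dvd ?s ^ size A" if "set_mset A \<subseteq> prime_factors p" for A
    using that
  proof (induction A)
    case (add q A)
    have "q dvd ?s"
      using add.prems False by (auto simp: sqfree_part_def intro!: dvd_prodI[where f = "\<lambda>x. x"])
    then show ?case
      using add by (auto intro: mult_dvd_mono)
  qed simp
  from this[of "prime_factorization p"] have "p dvd ?s ^ size (prime_factorization p)"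
    by (metis False normalize_dvd_iff prod_mset_prime_factorization_weak subset_refl)
  then show ?thesis ..
qed

interpretation eval2_hom: comm_ring_hom "\<lambda>p. eval2 p x y" for x y
  by unfold_locales (simp_all add: eval2_def)

lemma eval2_sqfree_part_eq_0_iff: "eval2 (sqfree_part p) x y = 0 \<longleftrightarrow> eval2 p x y = 0"
proof
  assume "eval2 (sqfree_part p) x y = 0"
  then show "eval2 p x y = 0"
    using eval2_hom.hom_dvd[OF sqfree_part_dvd[of p], of x y] by simp
next
  assume *: "eval2 p x y = 0"
  obtain n where "p dvd sqfree_part p ^ n"
    using dvd_sqfree_part_power by blast
  from eval2_hom.hom_dvd[OF this, of x y] * show "eval2 (sqfree_part p) x y = 0"
    by (simp add: eval2_hom.hom_power)
qed

definition specialize :: "real poly poly poly \<Rightarrow> real \<Rightarrow> real \<Rightarrow> real poly" where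
  "specialize P x y = map_poly (\<lambda>p. eval2 p x y) P"

lemma poly_specialize: "poly (specialize P x y) z = eval3 P x y z"
proof -
  have "eval2 (cst z) x y = z"
    by (simp add: eval2_def)
  then show ?thesis
    unfolding specialize_def eval3_def using eval2_hom.poly_map_poly[of x y P "cst z"] by simp
qed

lemma degree_specialize_monic:
  assumes "monic P"
  shows "degree (specialize P x y) = degree P"
  using assms unfolding specialize_def by (intro degree_map_poly) auto

lemma eval2_resultant_monic:
  assumes "monic P" and "monic Q"
  shows "eval2 (resultant P Q) x y = resultant (specialize P x y) (specialize Q x y)"
  using eval2_hom.resultant_map_poly[of x y P Q] degree_specialize_monic[OF assms(1), of x y]
    degree_specialize_monic[OF assms(2), of x y]
  by (simp add: specialize_def)

text \<open>
  With nonnegative discriminant the quadratic is a product of two real linear factors, and a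
  polynomial vanishing at neither root is coprime to both factors, hence to their product.
\<close>
lemma resultant_quadratic_eq_0_iff:
  fixes f :: "real poly" and u v :: real
  assumes "u\<^sup>2 - 4 * v \<ge> 0"
  shows "resultant f [:v, u, 1:] = 0 \<longleftrightarrow> (\<exists>z. poly f z = 0 \<and> poly [:v, u, 1:] z = 0)"
proof
  assume res: "resultant f [:v, u, 1:] = 0"
  define s t where "s = (- u + sqrt (u\<^sup>2 - 4 * v)) / 2" and "t = (- u - sqrt (u\<^sup>2 - 4 * v)) / 2"
  have "sqrt (u\<^sup>2 - 4 * v) * sqrt (u\<^sup>2 - 4 * v) = u\<^sup>2 - 4 * v"
    using assms by simp
  then have split: "[:v, u, 1:] = [:- s, 1:] * [:- t, 1:]"
    by (simp add: s_def t_def field_simps power2_eq_square)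
  have coprime_linear: "coprime f [:- c, 1:]" if "poly f c \<noteq> 0" for c
  proof -
    have "prime_elem [:- c, 1:]"
      by (rule prime_elem_linear_field_poly) simp
    with that show ?thesis
      using prime_elem_imp_coprime[of "[:- c, 1:]" f]
      by (simp add: poly_eq_0_iff_dvd coprime_commute)
  qed
  have "\<not> coprime f ([:- s, 1:] * [:- t, 1:])"
    using res unfolding split resultant_0_gcd by (auto simp: coprime_iff_gcd_eq_1)
  then have "poly f s = 0 \<or> poly f t = 0"
    using coprime_linear[of s] coprime_linear[of t] unfolding coprime_mult_right_iff by blast
  then show "\<exists>z. poly f z = 0 \<and> poly [:v, u, 1:] z = 0"
    unfolding split by auto
next
  assume "\<exists>z. poly f z = 0 \<and> poly [:v, u, 1:] z = 0"
  then obtain z where "[:- z, 1:] dvd f" and "[:- z, 1:] dvd [:v, u, 1:]"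
    unfolding poly_eq_0_iff_dvd by blast
  then have dvd: "[:- z, 1:] dvd gcd f [:v, u, 1:]"
    by simp
  have "gcd f [:v, u, 1:] \<noteq> 0"
    by simp
  from dvd_imp_degree_le[OF dvd this] show "resultant f [:v, u, 1:] = 0"
    unfolding resultant_0_gcd by simp
qed

lemma quadratic_root_imp_discriminant_nonneg:
  fixes u v z :: real
  assumes "z\<^sup>2 + u * z + v = 0"
  shows "u\<^sup>2 - 4 * v \<ge> 0"
proof -
  have "u\<^sup>2 - 4 * v = (2 * z + u)\<^sup>2"
    using assms by (simp add: power2_eq_square algebra_simps)
  then show ?thesis by simp
qed

lemma torus_zero_imp_Delta_T_nonpos:
  assumes "0 < r" and "r < R" and "eval3 (torus_poly R r) x y z = 0"
  shows "eval2 (Delta_T R r) x y \<le> 0"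
proof -
  have p2_nonneg: "eval2 (p2 R r) x y \<ge> 0"
  proof -
    have "r\<^sup>2 \<le> R\<^sup>2"
      using assms by (simp add: power_mono)
    then show ?thesis
      by (simp add: eval2_def p2_def)
  qed
  have "eval2 (p0 R r) x y = - (z\<^sup>2 * (z\<^sup>2 + eval2 (p2 R r) x y))"
    using assms(3) by (simp add: eval3_def eval2_def torus_poly_def algebra_simps power2_eq_square)
  with p2_nonneg show ?thesis
    by (simp add: Delta_T_def)
qed

theorem theorem2p1:
  fixes R r a b d e f g h i j :: real
  defines "T \<equiv> torus_poly R r"
    and "Q \<equiv> quadric_poly (q1 e f i) (q0 a b d g h j)"
  assumes "0 < r" and "r < R"
    and "irreducible Q"
  shows "proj_z ` (zero_set T \<inter> zero_set Q) =
    {(x, y). eval2 (S0_hat T Q) x y = 0 \<and>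
             eval2 (Delta_T R r) x y \<le> 0 \<and>
             eval2 (Delta_Q (q1 e f i) (q0 a b d g h j)) x y \<ge> 0}"
proof -
  have fibre: "(\<exists>z. eval3 T x y z = 0 \<and> eval3 Q x y z = 0) \<longleftrightarrow>
      eval2 (S0_hat T Q) x y = 0 \<and> eval2 (Delta_T R r) x y \<le> 0 \<and>
      eval2 (Delta_Q (q1 e f i) (q0 a b d g h j)) x y \<ge> 0" (is "?common \<longleftrightarrow> _") for x y
  proof -
    define u v where "u = eval2 (q1 e f i) x y" and "v = eval2 (q0 a b d g h j) x y"
    have disc: "eval2 (Delta_Q (q1 e f i) (q0 a b d g h j)) x y = u\<^sup>2 - 4 * v"
      by (simp add: Delta_Q_def u_def v_def eval2_def)
    have spec_Q: "specialize Q x y = [:v, u, 1:]"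
      by (simp add: specialize_def Q_def quadric_poly_def u_def v_def)
    have "monic T" "monic Q"
      by (simp_all add: T_def Q_def torus_poly_def quadric_poly_def)
    then have S0: "eval2 (S0_hat T Q) x y = 0 \<longleftrightarrow> resultant (specialize T x y) [:v, u, 1:] = 0"
      by (simp add: S0_hat_def S0_tilde_def eval2_sqfree_part_eq_0_iff eval2_resultant_monic spec_Q)
    have common_roots: "?common \<longleftrightarrow> (\<exists>z. poly (specialize T x y) z = 0 \<and> poly [:v, u, 1:] z = 0)"
      unfolding spec_Q[symmetric] poly_specialize ..
    have "u\<^sup>2 - 4 * v \<ge> 0" if "?common"
    proof -
      from that obtain z where "poly [:v, u, 1:] z = 0"
        unfolding common_roots by blast
      then have "z\<^sup>2 + u * z + v = 0"
        by (simp add: algebra_simps power2_eq_square)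
      then show ?thesis
        by (rule quadratic_root_imp_discriminant_nonneg)
    qed
    moreover have "eval2 (Delta_T R r) x y \<le> 0" if "?common"
      using that torus_zero_imp_Delta_T_nonpos[OF assms(3,4)] unfolding T_def by blast
    ultimately show ?thesis
      using resultant_quadratic_eq_0_iff[of u v "specialize T x y"] S0 common_roots disc by metis
  qed
  have "proj_z ` (zero_set T \<inter> zero_set Q) = {(x, y). \<exists>z. eval3 T x y z = 0 \<and> eval3 Q x y z = 0}"
    by (force simp: proj_z_def zero_set_def)
  then show ?thesis
    unfolding fibre .
qed

end
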